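(* Let $p$ be a prime number and let $n, k$ be positive integers with $k \ge n+1$. Let $X_1, \ldots, X_k \in \mathbb{Q}^n$ and $y_1, \ldots, y_k \in \mathbb{Q}$ be such that, for all $i,j$, $y_i \ne y_j$ implies $X_i \ne X_j$. Suppose that $X_1, \ldots, X_k$ is non-degenerate, that is, there is no non-zero affine function $\phi : \mathbb{Q}^n \to \mathbb{Q}$ with $\phi(X_i) = 0$ for all $i \in \{1,\ldots,k\}$. Then there is an affine function $M : \mathbb{Q}^n \to \mathbb{Q}$ which minimises $\sum_{i=1}^{k} |M(X_i) - y_i|_p$ among all affine functions $\mathbb{Q}^n \to \mathbb{Q}$, and which satisfies $M(X_i) - y_i = 0$ for at least $n+1$ distinct values of the index $i$. Moreover, every affine function $\mathbb{Q}^n \to \mathbb{Q}$ minimising this sum has the latter property, i.e. its residual vanishes for at least $n+1$ distinct values of $i$.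
   Context: $|\cdot|_p$ is the $p$-adic absolute value on $\mathbb{Q}$: $|0|_p = 0$ and $|x|_p = p^{-v_p(x)}$ for $x \ne 0$, where $v_p$ is the $p$-adic valuation. An affine function $F : \mathbb{Q}^n \to \mathbb{Q}$ is one of the form $F(x_1,\ldots,x_n) = v_1 x_1 + \cdots + v_n x_n + v_{n+1}$ with $v_1, \ldots, v_{n+1} \in \mathbb{Q}$; it is non-zero if it is not identically zero. *)

theory Defs
  imports "HOL-Analysis.Analysis" "HOL-Computational_Algebra.Primes"
begin

text \<open>
  \<open>quotient_of x\<close> is the reduced fraction of \<open>x\<close>, so at most one of the two
  multiplicities is nonzero.  The value at \<open>x = 0\<close> is irrelevant.
\<close>
definition padic_val :: "nat \<Rightarrow> rat \<Rightarrow> int" where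
  "padic_val p x =
     int (multiplicity (int p) (fst (quotient_of x))) -
     int (multiplicity (int p) (snd (quotient_of x)))"

definition padic_abs :: "nat \<Rightarrow> rat \<Rightarrow> real" where
  "padic_abs p x = (if x = 0 then 0 else real p powi (- padic_val p x))"

definition affine_fun :: "(rat ^ 'n \<Rightarrow> rat) \<Rightarrow> bool" where
  "affine_fun F \<longleftrightarrow> (\<exists>v c. \<forall>x. F x = (\<Sum>j\<in>UNIV. v $ j * x $ j) + c)"

definition nondegenerate :: "nat \<Rightarrow> (nat \<Rightarrow> rat ^ 'n) \<Rightarrow> bool" where
  "nondegenerate k X \<longleftrightarrow>
     \<not> (\<exists>\<phi>. affine_fun \<phi> \<and> (\<exists>x. \<phi> x \<noteq> 0) \<and> (\<forall>i\<in>{1..k}. \<phi> (X i) = 0))"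

definition padic_loss ::
  "nat \<Rightarrow> nat \<Rightarrow> (nat \<Rightarrow> rat ^ 'n) \<Rightarrow> (nat \<Rightarrow> rat) \<Rightarrow> (rat ^ 'n \<Rightarrow> rat) \<Rightarrow> real" where
  "padic_loss p k X y M = (\<Sum>i=1..k. padic_abs p (M (X i) - y i))"

end

theory Submission
  imports Defs
begin

text \<open>
  Suppose the points at which the residual of \<open>M\<close> vanishes all lie in the zero set of some
  non-zero affine \<open>\<phi>\<close>.  Among the indices with \<open>\<phi> (X i) \<noteq> 0\<close> choose \<open>j\<close> such that
  \<open>t = (y j - M (X j)) / \<phi> (X j)\<close> has least absolute value.  By the ultrametric inequality,
  passing to \<open>M + t \<phi>\<close> increases no residual, and it turns the non-zero residual at \<open>j\<close> into zero;
  so the loss drops strictly and the set of vanishing residuals grows strictly.  A minimiser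
  therefore has a set of vanishing residuals on which no non-zero affine function vanishes, which
  forces at least \<open>n + 1\<close> indices.  Iterating, every affine function is dominated by one with this
  property; since such a function is determined by its set of vanishing residuals, there are only
  finitely many of them, and the best one is a minimiser.
\<close>

section \<open>The p-adic absolute value\<close>

text \<open>Cross-multiplying with the reduced fraction and comparing multiplicities of the prime on
  both sides shows that the valuation can be read off any fraction, reduced or not.\<close>

lemma padic_val_fraction:
  assumes "prime p" "a \<noteq> 0" "b \<noteq> 0"
  shows "padic_val p (of_int a / of_int b) =
           int (multiplicity (int p) a) - int (multiplicity (int p) b)"
proof -
  obtain c d where q: "quotient_of (of_int a / of_int b :: rat) = (c, d)"
    by (cases "quotient_of (of_int a / of_int b :: rat)")
  have d: "d > 0" using quotient_of_denom_pos[OF q] .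
  have eq: "(of_int a / of_int b :: rat) = of_int c / of_int d"
    using quotient_of_div[OF q] .
  have "(of_int (a * d) :: rat) = of_int (c * b)"
    using eq assms(3) d by (simp add: field_simps)
  hence ad: "a * d = c * b" by (simp only: of_int_eq_iff)
  have c: "c \<noteq> 0" using ad assms d by auto
  have pp: "prime_elem (int p)" using assms(1) by simp
  have "multiplicity (int p) (a * d) = multiplicity (int p) a + multiplicity (int p) d"
    using pp assms d by (intro prime_elem_multiplicity_mult_distrib) auto
  moreover have "multiplicity (int p) (c * b) = multiplicity (int p) c + multiplicity (int p) b"
    using pp assms c by (intro prime_elem_multiplicity_mult_distrib) auto
  ultimately show ?thesis using ad by (simp add: padic_val_def q)
qed

lemma rat_common_denominator:
  fixes x y :: rat
  obtains a b c :: int where "c \<noteq> 0" "x = of_int a / of_int c" "y = of_int b / of_int c"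
proof -
  obtain a1 c1 where 1: "quotient_of x = (a1, c1)" by (cases "quotient_of x")
  obtain a2 c2 where 2: "quotient_of y = (a2, c2)" by (cases "quotient_of y")
  have "c1 > 0" "c2 > 0" using quotient_of_denom_pos[OF 1] quotient_of_denom_pos[OF 2] .
  moreover have "x = of_int a1 / of_int c1" "y = of_int a2 / of_int c2"
    using quotient_of_div[OF 1] quotient_of_div[OF 2] .
  ultimately show ?thesis
    by (intro that[of "c1 * c2" "a1 * c2" "a2 * c1"]) (auto simp: field_simps)
qed

lemma padic_val_mult:
  assumes "prime p" "x \<noteq> 0" "y \<noteq> 0"
  shows "padic_val p (x * y) = padic_val p x + padic_val p y"
proof -
  obtain a b c where c: "c \<noteq> 0" and x: "x = of_int a / of_int c" and y: "y = of_int b / of_int c"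
    by (rule rat_common_denominator)
  have ab: "a \<noteq> 0" "b \<noteq> 0" using assms x y by auto
  have pp: "prime_elem (int p)" using assms(1) by simp
  have "x * y = of_int (a * b) / of_int (c * c)" by (simp add: x y)
  hence "padic_val p (x * y) =
      int (multiplicity (int p) (a * b)) - int (multiplicity (int p) (c * c))"
    using padic_val_fraction[OF assms(1), of "a * b" "c * c"] ab c by simp
  thus ?thesis
    using padic_val_fraction[OF assms(1)] ab c pp
    by (simp add: x y prime_elem_multiplicity_mult_distrib)
qed

lemma padic_val_diff:
  assumes "prime p" "x \<noteq> 0" "y \<noteq> 0" "x \<noteq> y"
  shows "padic_val p (x - y) \<ge> min (padic_val p x) (padic_val p y)"
proof -
  obtain a b c where c: "c \<noteq> 0" and x: "x = of_int a / of_int c" and y: "y = of_int b / of_int c"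
    by (rule rat_common_denominator)
  have ab: "a \<noteq> 0" "b \<noteq> 0" "a - b \<noteq> 0" using assms x y by auto
  define m where "m = min (multiplicity (int p) a) (multiplicity (int p) b)"
  \<comment> \<open>Over a common denominator the ultrametric inequality becomes a divisibility: a
    power of \<open>p\<close> dividing both numerators divides their difference.\<close>
  have "int p ^ m dvd a" "int p ^ m dvd b"
    by (auto simp: m_def intro: multiplicity_dvd')
  hence "int p ^ m dvd a - b" by (rule dvd_diff)
  moreover have "\<not> is_unit (int p)" using assms(1) by (auto dest: prime_gt_1_nat)
  ultimately have "m \<le> multiplicity (int p) (a - b)"
    using ab by (intro multiplicity_geI) auto
  moreover have "x - y = of_int (a - b) / of_int c" by (simp add: x y diff_divide_distrib)
  ultimately have "padic_val p (x - y) \<ge> int m - int (multiplicity (int p) c)"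
    using padic_val_fraction[OF assms(1) ab(3) c] by simp
  thus ?thesis
    using padic_val_fraction[OF assms(1) _ c] ab
    by (simp add: x y m_def min_def split: if_splits)
qed

lemma padic_abs_nonneg [simp]: "padic_abs p x \<ge> 0"
  by (simp add: padic_abs_def)

lemma padic_abs_0 [simp]: "padic_abs p 0 = 0"
  by (simp add: padic_abs_def)

lemma padic_abs_pos: "prime p \<Longrightarrow> x \<noteq> 0 \<Longrightarrow> padic_abs p x > 0"
  by (auto simp: padic_abs_def prime_gt_0_nat)

lemma padic_abs_mult:
  assumes "prime p"
  shows "padic_abs p (x * y) = padic_abs p x * padic_abs p y"
  using assms prime_gt_0_nat[OF assms]
  by (auto simp: padic_abs_def padic_val_mult simp flip: power_int_add)

lemma padic_abs_minus:
  assumes "prime p"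
  shows "padic_abs p (- x) = padic_abs p x"
  using padic_abs_mult[OF assms, of "- 1" x] multiplicity_unit_right[of "- 1" "int p"]
  by (simp add: padic_abs_def padic_val_def)

lemma padic_abs_diff:
  assumes "prime p"
  shows "padic_abs p (x - y) \<le> max (padic_abs p x) (padic_abs p y)"
proof (cases "x = 0 \<or> y = 0 \<or> x = y")
  case True
  with assms show ?thesis by (auto simp: padic_abs_minus le_max_iff_disj)
next
  case False
  hence "- padic_val p (x - y) \<le> max (- padic_val p x) (- padic_val p y)"
    using padic_val_diff[OF assms, of x y] by auto
  moreover have "real p \<ge> 1" using prime_gt_0_nat[OF assms] by simp
  ultimately show ?thesis using False
    by (auto simp: padic_abs_def le_max_iff_disj intro: power_int_increasing)
qed

section \<open>Affine functions\<close>

lemma affine_fun_add_scaled: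
  assumes "affine_fun F" "affine_fun G"
  shows "affine_fun (\<lambda>x. F x + t * G x)"
proof -
  obtain v c w d where "\<And>x. F x = (\<Sum>j\<in>UNIV. v $ j * x $ j) + c"
    and "\<And>x. G x = (\<Sum>j\<in>UNIV. w $ j * x $ j) + d"
    using assms unfolding affine_fun_def by blast
  hence "F x + t * G x = (\<Sum>j\<in>UNIV. (v + t *s w) $ j * x $ j) + (c + t * d)" for x
    by (simp add: sum.distrib sum_distrib_left algebra_simps)
  thus ?thesis unfolding affine_fun_def by blast
qed

lemma affine_fun_zero: "affine_fun (\<lambda>x. 0)"
  unfolding affine_fun_def by (intro exI[of _ 0]) simp

text \<open>The vectors become rows of a square matrix padded with zero rows. Its row space is too
  small to be everything, so the matrix has a non-trivial kernel, and any non-zero kernel vector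
  serves as \<open>w\<close>.\<close>

lemma exists_nonzero_annihilator:
  fixes S :: "('a::field ^ 'm) set"
  assumes "finite S" "card S < CARD('m)"
  obtains w :: "'a ^ 'm" where "w \<noteq> 0" "\<And>s. s \<in> S \<Longrightarrow> (\<Sum>j\<in>UNIV. s $ j * w $ j) = 0"
proof -
  obtain f :: "'a ^ 'm \<Rightarrow> 'm" where f: "inj_on f S"
    using assms card_le_inj[of S "UNIV :: 'm set"] by auto
  define A :: "'a ^ 'm ^ 'm" where
    "A = (\<chi> r. if r \<in> f ` S then inv_into S f r else 0)"
  have "rows A \<subseteq> insert 0 S"
    by (auto simp: rows_def row_def A_def f)
  hence "vec.span (rows A) \<subseteq> vec.span S"
    by (metis vec.span_insert_0 vec.span_mono)
  hence "vec.dim (vec.span (rows A)) \<le> card S"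
    using vec.dim_le_card assms(1) by metis
  hence "vec.span (rows A) \<noteq> UNIV"
    using assms(2) vec_dim_card[where 'a='a and 'n='m] by (metis linorder_not_less)
  hence "\<not> (\<forall>x. A *v x = 0 \<longrightarrow> x = 0)"
    by (simp add: matrix_left_invertible_span_rows_gen flip: matrix_left_invertible_ker)
  then obtain w where w: "A *v w = 0" "w \<noteq> 0" by blast
  have "(\<Sum>j\<in>UNIV. s $ j * w $ j) = 0" if "s \<in> S" for s
  proof -
    have "A $ f s = s" using that f by (simp add: A_def)
    moreover have "(A *v w) $ f s = 0" by (simp add: w)
    ultimately show ?thesis by (simp add: matrix_vector_mult_def)
  qed
  with w that show ?thesis by blast
qed

lemma exists_affine_vanishing:
  fixes S :: "(rat ^ 'n) set"
  assumes "finite S" "card S \<le> CARD('n)"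
  obtains \<phi> :: "rat ^ 'n \<Rightarrow> rat"
  where "affine_fun \<phi>" "\<exists>x. \<phi> x \<noteq> 0" "\<And>s. s \<in> S \<Longrightarrow> \<phi> s = 0"
proof -
  \<comment> \<open>Homogenisation: with an extra coordinate 1 at \<open>None\<close>, affine
    functions become linear forms in one dimension more, and \<open>w $ None\<close> is the constant
    term.\<close>
  define h :: "rat ^ 'n \<Rightarrow> rat ^ 'n option" where
    "h = (\<lambda>x. \<chi> r. case r of None \<Rightarrow> 1 | Some j \<Rightarrow> x $ j)"
  have "card (h ` S) < CARD('n option)"
    using card_image_le[OF assms(1), of h] assms(2) by simp
  then obtain w :: "rat ^ 'n option" where w: "w \<noteq> 0"
      "\<And>s. s \<in> h ` S \<Longrightarrow> (\<Sum>j\<in>UNIV. s $ j * w $ j) = 0"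
    using exists_nonzero_annihilator[of "h ` S"] assms(1) by blast
  define \<phi> where "\<phi> = (\<lambda>x. (\<Sum>j\<in>UNIV. (\<chi> j. w $ Some j) $ j * x $ j) + w $ None)"
  have \<phi>: "\<phi> x = (\<Sum>j\<in>UNIV. h x $ j * w $ j)" for x
  proof -
    have "(\<Sum>j\<in>UNIV. h x $ j * w $ j) = (\<Sum>j\<in>insert None (range Some). h x $ j * w $ j)"
      by (simp only: UNIV_option_conv)
    also have "\<dots> = w $ None + (\<Sum>j\<in>UNIV. x $ j * w $ Some j)"
      by (subst sum.insert) (auto simp: h_def sum.reindex)
    finally show ?thesis by (simp add: \<phi>_def mult.commute)
  qed
  have "affine_fun \<phi>" unfolding affine_fun_def \<phi>_def by blast
  moreover have "\<exists>x. \<phi> x \<noteq> 0"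
  proof (rule ccontr)
    assume "\<not> ?thesis"
    hence z: "\<phi> x = 0" for x by blast
    \<comment> \<open>The values at the origin and at the unit vectors recover all
      coefficients.\<close>
    have None: "w $ None = 0" using z[of 0] by (simp add: \<phi>_def)
    have "w $ Some j = 0" for j
      using z[of "axis j 1"] None by (simp add: \<phi>_def axis_def if_distrib[of "(*) _"] cong: if_cong)
    with None have "w $ r = 0" for r by (cases r) auto
    with w(1) show False by (simp add: vec_eq_iff)
  qed
  moreover have "\<phi> s = 0" if "s \<in> S" for s
    using w(2)[of "h s"] that by (simp add: \<phi>)
  ultimately show ?thesis using that by blast
qed

section \<open>Decreasing the loss\<close>

definition vanishing_residuals ::
  "nat \<Rightarrow> (nat \<Rightarrow> rat ^ 'n) \<Rightarrow> (nat \<Rightarrow> rat) \<Rightarrow> (rat ^ 'n \<Rightarrow> rat) \<Rightarrow> nat set" where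
  "vanishing_residuals k X y M = {i \<in> {1..k}. M (X i) - y i = 0}"

lemma finite_vanishing_residuals [simp]: "finite (vanishing_residuals k X y M)"
  by (simp add: vanishing_residuals_def)

text \<open>Term from interpolation theory: the values at these points determine an affine function.
  For \<open>Z = {1..k}\<close> this is \<open>nondegenerate k X\<close>.\<close>

definition unisolvent :: "(nat \<Rightarrow> rat ^ 'n) \<Rightarrow> nat set \<Rightarrow> bool" where
  "unisolvent X Z \<longleftrightarrow> (\<forall>\<phi>. affine_fun \<phi> \<longrightarrow> (\<forall>i\<in>Z. \<phi> (X i) = 0) \<longrightarrow> (\<forall>x. \<phi> x = 0))"

lemma card_unisolvent:
  fixes X :: "nat \<Rightarrow> rat ^ 'n"
  assumes "finite Z" "unisolvent X Z"
  shows "card Z \<ge> CARD('n) + 1"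
proof (rule ccontr)
  assume "\<not> ?thesis"
  hence "card (X ` Z) \<le> CARD('n)"
    using card_image_le[OF assms(1), of X] by linarith
  then obtain \<phi> where "affine_fun \<phi>" "\<exists>x. \<phi> x \<noteq> 0" "\<And>s. s \<in> X ` Z \<Longrightarrow> \<phi> s = 0"
    using exists_affine_vanishing[of "X ` Z"] assms(1) by auto
  with assms(2) show False unfolding unisolvent_def by blast
qed

lemma unisolvent_unique:
  assumes "affine_fun M" "affine_fun N" "unisolvent X Z" "\<And>i. i \<in> Z \<Longrightarrow> M (X i) = N (X i)"
  shows "M = N"
proof
  fix x
  have "affine_fun (\<lambda>x. M x + (-1) * N x)" by (rule affine_fun_add_scaled[OF assms(1,2)])
  with assms(3,4) have "M x + (-1) * N x = 0" unfolding unisolvent_def by fastforce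
  thus "M x = N x" by simp
qed

lemma padic_loss_improve:
  fixes X :: "nat \<Rightarrow> rat ^ 'n"
  assumes "prime p" "nondegenerate k X" "affine_fun M"
    and "\<not> unisolvent X (vanishing_residuals k X y M)"
  obtains N where "affine_fun N" "padic_loss p k X y N < padic_loss p k X y M"
    "vanishing_residuals k X y M \<subset> vanishing_residuals k X y N"
proof -
  obtain \<phi> where \<phi>: "affine_fun \<phi>" "\<exists>x. \<phi> x \<noteq> 0"
    and \<phi>0: "\<And>i. i \<in> vanishing_residuals k X y M \<Longrightarrow> \<phi> (X i) = 0"
    using assms(4) unfolding unisolvent_def by blast
  define S where "S = {i \<in> {1..k}. \<phi> (X i) \<noteq> 0}"
  \<comment> \<open>For \<open>i \<in> S\<close>, \<open>a i\<close> is the unique \<open>t\<close>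
    for which \<open>M + t \<phi>\<close> has zero residual at \<open>i\<close>.\<close>
  define a where "a = (\<lambda>i. (y i - M (X i)) / \<phi> (X i))"
  have "S \<noteq> {}"
    using \<phi> assms(2) unfolding nondegenerate_def S_def by blast
  moreover have "finite S" by (simp add: S_def)
  ultimately obtain j where j: "is_arg_min (\<lambda>i. padic_abs p (a i)) (\<lambda>i. i \<in> S) j"
    using ex_is_arg_min_if_finite by blast
  have jS: "j \<in> S" using j by (simp add: is_arg_min_def)
  have jmin: "padic_abs p (a j) \<le> padic_abs p (a i)" if "i \<in> S" for i
    using j that by (auto simp: is_arg_min_linorder)
  define N where "N = (\<lambda>x. M x + a j * \<phi> x)"
  have N: "affine_fun N" unfolding N_def by (rule affine_fun_add_scaled[OF assms(3) \<phi>(1)])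
  have Nj: "N (X j) - y j = 0" using jS by (simp add: N_def a_def S_def)
  \<comment> \<open>A zero residual at \<open>j\<close> would force \<open>\<phi> (X j) = 0\<close>,
    against \<open>j \<in> S\<close>.\<close>
  have Mj: "M (X j) - y j \<noteq> 0"
    using jS \<phi>0[of j] by (auto simp: S_def vanishing_residuals_def)
  have le: "padic_abs p (N (X i) - y i) \<le> padic_abs p (M (X i) - y i)" if "i \<in> {1..k}" for i
  proof (cases "i \<in> S")
    case True
    hence nz: "\<phi> (X i) \<noteq> 0" by (simp add: S_def)
    \<comment> \<open>The residual of \<open>M\<close> is the same expression with 0 in place of
      \<open>a j\<close>. So it suffices to compare \<open>a j - a i\<close> with
      \<open>0 - a i\<close>, where the ultrametric inequality and the minimality of
      \<open>a j\<close> apply.\<close>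
    have "N (X i) - y i = (a j - a i) * \<phi> (X i)"
      using nz by (simp add: N_def a_def field_simps)
    hence "padic_abs p (N (X i) - y i) = padic_abs p (a j - a i) * padic_abs p (\<phi> (X i))"
      using assms(1) by (simp add: padic_abs_mult)
    also have "padic_abs p (a j - a i) \<le> padic_abs p (0 - a i)"
      using padic_abs_diff[OF assms(1), of "a j" "a i"] jmin[OF True] assms(1)
      by (simp add: padic_abs_minus)
    also have "padic_abs p (0 - a i) * padic_abs p (\<phi> (X i)) = padic_abs p (M (X i) - y i)"
      using nz assms(1) by (simp add: a_def flip: padic_abs_mult)
    finally show ?thesis by (simp add: mult_right_mono)
  next
    case False
    with that show ?thesis by (simp add: N_def S_def)
  qed
  have "padic_loss p k X y N < padic_loss p k X y M"
    unfolding padic_loss_def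
  proof (rule sum_strict_mono_ex1)
    show "\<exists>i\<in>{1..k}. padic_abs p (N (X i) - y i) < padic_abs p (M (X i) - y i)"
      using jS Nj padic_abs_pos[OF assms(1) Mj] by (intro bexI[of _ j]) (auto simp: S_def)
  qed (use le in auto)
  moreover have "vanishing_residuals k X y M \<subset> vanishing_residuals k X y N"
  proof
    show "vanishing_residuals k X y M \<subseteq> vanishing_residuals k X y N"
      using \<phi>0 by (auto simp: vanishing_residuals_def N_def)
    show "vanishing_residuals k X y M \<noteq> vanishing_residuals k X y N"
      using jS Nj Mj by (auto simp: vanishing_residuals_def S_def)
  qed
  ultimately show ?thesis using N that by blast
qed

section \<open>Reduction to finitely many candidates\<close>

lemma unisolvent_dominates:
  fixes X :: "nat \<Rightarrow> rat ^ 'n"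
  assumes "prime p" "nondegenerate k X" "affine_fun M"
  shows "\<exists>N. affine_fun N \<and> unisolvent X (vanishing_residuals k X y N) \<and>
             padic_loss p k X y N \<le> padic_loss p k X y M"
  using assms(3)
\<comment> \<open>The measure counts the non-zero residuals. Each improvement lowers it strictly,
  since a vanishing set has at most \<open>k\<close> elements and the subtraction never
  truncates.\<close>
proof (induction "k - card (vanishing_residuals k X y M)" arbitrary: M rule: less_induct)
  case less
  show ?case
  proof (cases "unisolvent X (vanishing_residuals k X y M)")
    case True
    with less.prems show ?thesis by blast
  next
    case False
    then obtain M' where M': "affine_fun M'" "padic_loss p k X y M' < padic_loss p k X y M"
      "vanishing_residuals k X y M \<subset> vanishing_residuals k X y M'"
      using padic_loss_improve[OF assms(1,2) less.prems] by metis
    have "card (vanishing_residuals k X y M) < card (vanishing_residuals k X y M')"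
      using M'(3) by (intro psubset_card_mono) auto
    moreover have "card (vanishing_residuals k X y M') \<le> card {1..k}"
      by (intro card_mono) (auto simp: vanishing_residuals_def)
    ultimately have "k - card (vanishing_residuals k X y M')
        < k - card (vanishing_residuals k X y M)" by simp
    from less.hyps[OF this M'(1)] M'(2) show ?thesis by force
  qed
qed

lemma finite_unisolvent:
  "finite {M. affine_fun M \<and> unisolvent X (vanishing_residuals k X y M)}" (is "finite ?C")
proof (rule finite_imageD)
  have "vanishing_residuals k X y ` ?C \<subseteq> Pow {1..k}" by (auto simp: vanishing_residuals_def)
  thus "finite (vanishing_residuals k X y ` ?C)" by (rule finite_subset) simp
  \<comment> \<open>Two candidates with the same vanishing set both interpolate \<open>y\<close>
    there, and unisolvence makes them equal.\<close>
  show "inj_on (vanishing_residuals k X y) ?C"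
  proof (rule inj_onI)
    fix M N assume M: "M \<in> ?C" and N: "N \<in> ?C"
      and eq: "vanishing_residuals k X y M = vanishing_residuals k X y N"
    have "M (X i) = N (X i)" if "i \<in> vanishing_residuals k X y M" for i
      using that that[unfolded eq] by (simp add: vanishing_residuals_def)
    with M N show "M = N" by (blast intro: unisolvent_unique)
  qed
qed

theorem theorem1:
  fixes p k :: nat
    and X :: "nat \<Rightarrow> rat ^ 'n"
    and y :: "nat \<Rightarrow> rat"
  assumes "prime p"
    and "k \<ge> CARD('n) + 1"
    and "\<And>i j. i \<in> {1..k} \<Longrightarrow> j \<in> {1..k} \<Longrightarrow> y i \<noteq> y j \<Longrightarrow> X i \<noteq> X j"
    and "nondegenerate k X"
  shows "(\<exists>M. is_arg_min (padic_loss p k X y) affine_fun M \<and>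
              card {i \<in> {1..k}. M (X i) - y i = 0} \<ge> CARD('n) + 1) \<and>
         (\<forall>M. is_arg_min (padic_loss p k X y) affine_fun M \<longrightarrow>
              card {i \<in> {1..k}. M (X i) - y i = 0} \<ge> CARD('n) + 1)"
proof -
  have minimisers: "card {i \<in> {1..k}. M (X i) - y i = 0} \<ge> CARD('n) + 1"
    if M: "is_arg_min (padic_loss p k X y) affine_fun M" for M
  proof -
    \<comment> \<open>Otherwise \<open>padic_loss_improve\<close> would yield an affine function of
      strictly smaller loss.\<close>
    have "unisolvent X (vanishing_residuals k X y M)"
      using M padic_loss_improve[OF assms(1,4)] unfolding is_arg_min_def by metis
    hence "card (vanishing_residuals k X y M) \<ge> CARD('n) + 1"
      by (intro card_unisolvent) auto
    thus ?thesis by (simp add: vanishing_residuals_def)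
  qed
  define C where "C = {M. affine_fun M \<and> unisolvent X (vanishing_residuals k X y M)}"
  have dom: "\<exists>N\<in>C. padic_loss p k X y N \<le> padic_loss p k X y M" if "affine_fun M" for M
    using unisolvent_dominates[OF assms(1,4) that] unfolding C_def by blast
  have "finite C" unfolding C_def by (rule finite_unisolvent)
  \<comment> \<open>The zero function is only a starting point: some member of \<open>C\<close>
    dominates it.\<close>
  moreover have "C \<noteq> {}" using dom[OF affine_fun_zero] by blast
  ultimately obtain M where M: "is_arg_min (padic_loss p k X y) (\<lambda>M. M \<in> C) M"
    using ex_is_arg_min_if_finite by blast
  \<comment> \<open>Optimality within \<open>C\<close> is global, because every affine
    \<open>N\<close> is dominated by a member of \<open>C\<close>.\<close>
  have "padic_loss p k X y M \<le> padic_loss p k X y N" if "affine_fun N" for N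
    using dom[OF that] M by (force simp: is_arg_min_linorder)
  hence "is_arg_min (padic_loss p k X y) affine_fun M"
    using M by (simp add: is_arg_min_linorder C_def)
  with minimisers show ?thesis by blast
qed

end
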